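(* Let $\mathcal{A}$ be a complex Banach algebra with unit $1$, let $n\in\mathbb{N}$ and let $a,b\in\mathcal{A}^{pnsD}$ be such that $ab=0$. Then $a+b\in\mathcal{A}^{pnsD}$.
   Context: $\mathbb{N}$ is the set of positive integers. $\mathcal{J}(\mathcal{A})=\{a\in\mathcal{A}: 1+ay \text{ is invertible in } \mathcal{A} \text{ for all } y\in\mathcal{A}\}$ is the Jacobson radical. $\mathrm{Comm}(a)=\{x\in\mathcal{A}:xa=ax\}$ and $\mathrm{Comm}^2(a)=\{x\in\mathcal{A}: xy=yx \text{ for all } y\in\mathrm{Comm}(a)\}$. An element $a\in\mathcal{A}$ is pseudo $n$-strong Drazin invertible (p$n$s-Drazin invertible) if there exists $x\in\mathrm{Comm}^2(a)$ such that $xax=x$ and $(a^n-ax)^k\in\mathcal{J}(\mathcal{A})$ for some $k\in\mathbb{N}$. $\mathcal{A}^{pnsD}$ is the set of all p$n$s-Drazin invertible elements of $\mathcal{A}$. *)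

theory Defs
  imports Complex_Main
begin

text \<open>
  Unital complex Banach algebras. The norm, the ring structure and completeness come from the
  library classes for real algebras; the complex scalar multiplication extends \<open>scaleR\<close>.
  The class \<open>real_normed_algebra_1\<close> is deliberately not used: it would add \<open>norm 1 = 1\<close> and
  \<open>0 \<noteq> 1\<close>, and neither normalisation of the unit is needed here.
\<close>

class complex_banach_algebra_unital = real_normed_algebra + ring_1 + banach +
  fixes scaleC :: "complex \<Rightarrow> 'a \<Rightarrow> 'a"
  assumes scaleC_add_right: "scaleC c (x + y) = scaleC c x + scaleC c y"
    and scaleC_add_left: "scaleC (c + d) x = scaleC c x + scaleC d x"
    and scaleC_scaleC: "scaleC c (scaleC d x) = scaleC (c * d) x"
    and scaleC_of_real: "scaleC (complex_of_real r) x = scaleR r x"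
    and mult_scaleC_left: "scaleC c x * y = scaleC c (x * y)"
    and mult_scaleC_right: "x * scaleC c y = scaleC c (x * y)"
    and norm_scaleC: "norm (scaleC c x) = cmod c * norm x"

definition ring_invertible :: "'a::ring_1 \<Rightarrow> bool" where
  "ring_invertible u \<longleftrightarrow> (\<exists>v. u * v = 1 \<and> v * u = 1)"

definition jacobson_radical :: "'a::ring_1 set" where
  "jacobson_radical = {a. \<forall>y. ring_invertible (1 + a * y)}"

definition commutant :: "'a::ring_1 \<Rightarrow> 'a set" where
  "commutant a = {x. x * a = a * x}"

definition double_commutant :: "'a::ring_1 \<Rightarrow> 'a set" where
  "double_commutant a = {x. \<forall>y\<in>commutant a. x * y = y * x}"

definition pns_Drazin_invertible :: "nat \<Rightarrow> 'a::ring_1 \<Rightarrow> bool" where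
  "pns_Drazin_invertible n a \<longleftrightarrow>
     (\<exists>x\<in>double_commutant a. x * a * x = x \<and>
        (\<exists>k>0. (a ^ n - a * x) ^ k \<in> jacobson_radical))"

definition pnsD :: "nat \<Rightarrow> 'a::ring_1 set" where
  "pnsD n = {a. pns_Drazin_invertible n a}"

end

theory Submission
  imports Defs "HOL-Analysis.Topology_Euclidean_Space"
    "HOL-Computational_Algebra.Formal_Power_Series"
begin

text \<open>
  Write \<open>J\<close> for the Jacobson radical and \<open>q(t) = t^n - t^2n\<close>. The proof rests on a criterion that
  mentions no inverse: \<open>a\<close> is pseudo \<open>n\<close>-strong Drazin invertible if and only if \<open>q(a)\<close> is nilpotent
  modulo \<open>J\<close>.

  Necessity (\<open>pns_Drazin_imp_power_radical\<close>) is algebra: with \<open>p = ax\<close> idempotent and \<open>g = a^n - p\<close>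
  nilpotent modulo \<open>J\<close>, one gets \<open>q(a) = g (1 - 2p - g)\<close>.

  Sufficiency (\<open>power_radical_imp_pns_Drazin\<close>) has to lift the idempotent that \<open>u = a^n\<close> represents
  modulo \<open>J\<close> to an honest idempotent \<open>e\<close> in the double commutant of \<open>a\<close>. As \<open>u - u^2\<close> is nilpotent
  modulo \<open>J\<close>, all its complex multiples \<open>y\<close> have \<open>1 - y\<close> invertible, so its powers tend to zero faster
  than any geometric sequence (\<open>quasinilpotent_small_power\<close>, an elementary form of the spectral radius
  formula). Therefore the binomial series for \<open>(1 + x)^(-1/2)\<close> converges at \<open>x = (2u - 1)^2 - 1\<close>, and
  \<open>r = (2u - 1) (1 + x)^(-1/2)\<close> satisfies \<open>r^2 = 1\<close>; then \<open>e = (1 + r) / 2\<close> is the wanted idempotent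
  (\<open>spectral_idempotent\<close>). On the corner cut out by \<open>e\<close> the element \<open>a^n\<close> is the unit up to a part
  nilpotent modulo \<open>J\<close>, so \<open>a\<close> is invertible there, and its inverse in that corner is the Drazin
  inverse.

  With the criterion, the theorem concerns polynomials only (\<open>sum_power_radical\<close>). Put \<open>c = a + b\<close>.
  From \<open>ab = 0\<close> follow \<open>a f(c) = a f(a)\<close> and \<open>f(c) b = f(b) b\<close> for every polynomial \<open>f\<close>. For \<open>F = q(c)^k\<close>
  with \<open>k\<close> large, \<open>aF\<close> and \<open>Fb\<close> thus lie in \<open>J\<close>, hence so does \<open>F c F = F (aF) + (Fb) F\<close>. Because
  \<open>c\<close> divides \<open>q(c)\<close>, a further power of \<open>q(c)\<close> lies in \<open>J\<close>.
\<close>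

section \<open>Invertible elements and the Jacobson radical\<close>

lemma ring_invertibleI: "u * v = 1 \<Longrightarrow> v * u = 1 \<Longrightarrow> ring_invertible u"
  unfolding ring_invertible_def by blast

lemma ring_invertible_mult:
  assumes "ring_invertible u" "ring_invertible v"
  shows "ring_invertible (u * v)"
proof -
  obtain u' v' where "u * u' = 1" "u' * u = 1" "v * v' = 1" "v' * v = 1"
    using assms unfolding ring_invertible_def by blast
  then have "(u * v) * (v' * u') = 1" "(v' * u') * (u * v) = 1"
    by (metis mult.assoc mult_1_right)+
  then show ?thesis by (rule ring_invertibleI)
qed

lemma ring_invertible_commuting_factor:
  assumes "ring_invertible (u * v)" and comm: "u * v = v * u"
  shows "ring_invertible u"
proof -
  obtain w where w: "u * v * w = 1" "w * (u * v) = 1"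
    using assms(1) unfolding ring_invertible_def by blast
  have l: "(w * v) * u = 1" using w comm by (simp add: mult.assoc)
  have r: "u * (v * w) = 1" using w by (simp add: mult.assoc)
  have "w * v = v * w" using l r by (metis mult.assoc mult_1_left mult_1_right)
  then show ?thesis using l r by (metis ring_invertibleI)
qed

lemma commutes_mult:
  fixes y :: "'a::semigroup_mult"
  assumes "y * u = u * y" "y * v = v * y"
  shows "y * (u * v) = (u * v) * y"
  using assms by (metis mult.assoc)

lemma inverse_commutes:
  fixes u v y :: "'a::ring_1"
  assumes "u * v = 1" "v * u = 1" "y * u = u * y"
  shows "y * v = v * y"
  using assms by (metis mult.assoc mult_1_left mult_1_right)

text \<open>
  If \<open>v\<close> inverts \<open>1 + xy\<close>, then \<open>1 - y v x\<close> inverts \<open>1 + yx\<close>. The radical is introduced by a right-sided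
  condition; this swap makes it a left ideal as well.
\<close>

lemma ring_invertible_one_plus_swap:
  fixes x y :: "'a::ring_1"
  assumes "ring_invertible (1 + x * y)"
  shows "ring_invertible (1 + y * x)"
proof -
  obtain v where v: "(1 + x * y) * v = 1" "v * (1 + x * y) = 1"
    using assms unfolding ring_invertible_def by blast
  have "(1 + y * x) * (1 - y * v * x) = 1 + y * x - y * ((1 + x * y) * v) * x"
    by (simp add: algebra_simps)
  moreover have "(1 - y * v * x) * (1 + y * x) = 1 + y * x - y * (v * (1 + x * y)) * x"
    by (simp add: algebra_simps)
  ultimately show ?thesis using v by (intro ring_invertibleI[of _ "1 - y * v * x"]) simp_all
qed

lemma jacobson_radical_mult_right:
  "x \<in> jacobson_radical \<Longrightarrow> x * y \<in> jacobson_radical"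
  unfolding jacobson_radical_def by (simp add: mult.assoc)

lemma jacobson_radical_mult_left:
  assumes "x \<in> jacobson_radical"
  shows "y * x \<in> jacobson_radical"
proof -
  have "ring_invertible (1 + y * x * z)" for z
  proof -
    have "ring_invertible (1 + (x * z) * y)"
      using assms unfolding jacobson_radical_def by (simp add: mult.assoc)
    from ring_invertible_one_plus_swap[OF this] show ?thesis by (simp add: mult.assoc)
  qed
  then show ?thesis unfolding jacobson_radical_def by blast
qed

lemma jacobson_radical_add:
  assumes "x \<in> jacobson_radical" "y \<in> jacobson_radical"
  shows "x + y \<in> jacobson_radical"
proof -
  have "ring_invertible (1 + (x + y) * z)" for z
  proof -
    obtain v where v: "(1 + x * z) * v = 1" "v * (1 + x * z) = 1"
      using assms(1) unfolding jacobson_radical_def ring_invertible_def by blast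
    have "v * y \<in> jacobson_radical" using assms(2) by (rule jacobson_radical_mult_left)
    then have "ring_invertible (1 + v * y * z)" unfolding jacobson_radical_def by blast
    moreover have "ring_invertible (1 + x * z)" using v by (rule ring_invertibleI)
    ultimately have "ring_invertible ((1 + x * z) * (1 + v * y * z))"
      by (intro ring_invertible_mult)
    also have "(1 + x * z) * (1 + v * y * z) = 1 + x * z + ((1 + x * z) * v) * y * z"
      by (simp only: distrib_left mult_1_right mult.assoc)
    also have "\<dots> = 1 + (x + y) * z" using v by (simp add: algebra_simps)
    finally show ?thesis .
  qed
  then show ?thesis unfolding jacobson_radical_def by blast
qed

lemma commuting_power_mult:
  fixes x y :: "'a::monoid_mult"
  assumes "x * y = y * x"
  shows "(x * y) ^ k = x ^ k * y ^ k"
proof (induction k)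
  case (Suc k)
  have "y * x ^ k = x ^ k * y" using power_commuting_commutes[OF assms, of k] by simp
  then show ?case using Suc by (simp add: mult.assoc) (metis mult.assoc)
qed simp

text \<open>
  Being nilpotent modulo the radical passes to commuting multiples with the same exponent. Both
  directions of the criterion work by exhibiting such multiples.
\<close>

lemma jacobson_radical_power_multiple:
  assumes "x ^ k \<in> jacobson_radical" "x * y = y * x"
  shows "(x * y) ^ k \<in> jacobson_radical"
  unfolding commuting_power_mult[OF assms(2)]
  using assms(1) by (rule jacobson_radical_mult_right)

lemma jacobson_radical_power_mono:
  assumes "x ^ k \<in> jacobson_radical" "k \<le> l"
  shows "x ^ l \<in> jacobson_radical"
  using jacobson_radical_mult_right[OF assms(1), of "x ^ (l - k)"] assms(2)
  by (simp flip: power_add)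

text \<open>
  The finite geometric sum is a commuting cofactor of \<open>1 - x\<close> in \<open>1 - x^k\<close>, and the latter is
  invertible by the definition of the radical.
\<close>

lemma ring_invertible_one_minus:
  assumes "x ^ k \<in> jacobson_radical"
  shows "ring_invertible (1 - x)"
proof -
  have "1 - x ^ k = (1 - x) * (\<Sum>i<k. x ^ i)"
  proof (induction k)
    case (Suc k)
    have "(1 - x) * (\<Sum>i<Suc k. x ^ i) = (1 - x ^ k) + (1 - x) * x ^ k"
      by (simp only: Suc sum.lessThan_Suc distrib_left)
    also have "\<dots> = 1 - x ^ Suc k" by (simp add: left_diff_distrib)
    finally show ?case by simp
  qed simp
  moreover have "(1 - x) * (\<Sum>i<k. x ^ i) = (\<Sum>i<k. x ^ i) * (1 - x)"
  proof -
    have "x * (\<Sum>i<k. x ^ i) = (\<Sum>i<k. x ^ i) * x"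
      by (simp add: sum_distrib_left sum_distrib_right power_commutes)
    then show ?thesis by (simp add: left_diff_distrib right_diff_distrib)
  qed
  moreover have "ring_invertible (1 + x ^ k * (- 1))"
    using assms unfolding jacobson_radical_def by blast
  ultimately show ?thesis
    by (intro ring_invertible_commuting_factor[of "1 - x" "\<Sum>i<k. x ^ i"]) simp_all
qed

section \<open>The polynomial criterion: necessity\<close>

text \<open>
  In terms of \<open>p = ax\<close> and \<open>g = a^n - p\<close>, which commute, \<open>a^n (1 - a^n) = (p + g) (1 - p - g)\<close>, and here
  the summand \<open>p (1 - p)\<close> vanishes: \<open>g\<close> can be factored out.
\<close>

lemma pns_Drazin_imp_power_radical:
  fixes a :: "'a::ring_1"
  assumes "a \<in> pnsD n"
  obtains k where "(a ^ n - a ^ n * a ^ n) ^ k \<in> jacobson_radical"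
proof -
  obtain x k where x: "x \<in> double_commutant a" "x * a * x = x"
    and J: "(a ^ n - a * x) ^ k \<in> jacobson_radical"
    using assms unfolding pnsD_def pns_Drazin_invertible_def by blast
  define p where "p = a * x"
  define g where "g = a ^ n - p"
  have xa: "x * a = a * x"
    using x(1) unfolding double_commutant_def commutant_def by auto
  have pp: "p * p = p" unfolding p_def using x(2) by (simp add: mult.assoc)
  have pa: "p * a = a * p" unfolding p_def using xa by (simp add: mult.assoc)
  then have "p * a ^ n = a ^ n * p" by (metis power_commuting_commutes)
  then have gp: "p * g = g * p" unfolding g_def by (simp add: algebra_simps)
  have an: "a ^ n = p + g" unfolding g_def by simp
  have "a ^ n - a ^ n * a ^ n = g * (1 - p - p - g)"
    unfolding an using gp pp by (simp add: algebra_simps)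
  moreover have "g * (1 - p - p - g) = (1 - p - p - g) * g"
    using gp by (simp add: algebra_simps)
  ultimately show ?thesis
    using that[of k] jacobson_radical_power_multiple[of g k] J by (simp only: g_def p_def)
qed

section \<open>Quasinilpotent elements\<close>

lemma scaleC_one [simp]: "scaleC 1 (x :: 'a::complex_banach_algebra_unital) = x"
  using scaleC_of_real[of 1 x] by simp

lemma scaleC_zero [simp]: "scaleC 0 (x :: 'a::complex_banach_algebra_unital) = 0"
  using scaleC_of_real[of 0 x] by simp

lemma scaleC_minus_left: "scaleC (- c) (x :: 'a::complex_banach_algebra_unital) = - scaleC c x"
  using scaleC_add_left[of c "- c" x] by (simp add: minus_unique)

lemma scaleC_diff_left:
  "scaleC (c - d) (x :: 'a::complex_banach_algebra_unital) = scaleC c x - scaleC d x"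
  using scaleC_add_left[of c "- d" x] by (simp add: scaleC_minus_left)

lemma scaleC_power:
  "scaleC c (x :: 'a::complex_banach_algebra_unital) ^ k = scaleC (c ^ k) (x ^ k)"
  by (induction k) (simp_all add: mult_scaleC_left mult_scaleC_right scaleC_scaleC mult.commute)

text \<open>
  A Lipschitz bound for inversion at the unit. The norm of the unit is kept in the bound, since it
  may differ from \<open>1\<close> here.
\<close>

lemma norm_inverse_minus_one_le:
  fixes u v :: "'a::{real_normed_algebra, ring_1}"
  assumes "v * u = 1" and small: "norm (u - 1) \<le> 1 / 2"
  shows "norm (v - 1) \<le> 2 * norm (1 :: 'a) * norm (u - 1)"
proof -
  have "v - 1 = v * (1 - u)" using assms(1) by (simp add: algebra_simps)
  also have "\<dots> = (1 - u) + (v - 1) * (1 - u)" by (simp add: algebra_simps)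
  finally have "v - 1 = 1 * (1 - u) + (v - 1) * (1 - u)" by simp
  then have "norm (v - 1) \<le> norm (1 * (1 - u)) + norm ((v - 1) * (1 - u))"
    by (metis norm_triangle_ineq)
  also have "\<dots> \<le> norm (1 :: 'a) * norm (u - 1) + norm (v - 1) * norm (u - 1)"
    by (intro add_mono) (metis norm_mult_ineq norm_minus_commute)+
  also have "norm (v - 1) * norm (u - 1) \<le> norm (v - 1) * (1 / 2)"
    using small by (intro mult_left_mono) auto
  finally show ?thesis by simp
qed

text \<open>
  The resolvent identity bounds \<open>f y - f z\<close> by \<open>norm (f y)\<close> times a quantity that vanishes as
  \<open>y\<close> tends to \<open>z\<close>; this first makes \<open>f\<close> bounded near \<open>z\<close>, and then continuous at \<open>z\<close>.
\<close>

lemma resolvent_continuous_at: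
  fixes x :: "'a::complex_banach_algebra_unital"
  assumes l: "\<And>z. f z * (1 - scaleC z x) = 1" and r: "\<And>z. (1 - scaleC z x) * f z = 1"
  shows "isCont f z"
proof -
  define C where "C = norm x * norm (f z)"
  have C: "C \<ge> 0" unfolding C_def by simp
  have id: "f y - f z = f y * scaleC (y - z) x * f z" for y
  proof -
    have "f y * scaleC (y - z) x * f z = f y * ((1 - scaleC z x) - (1 - scaleC y x)) * f z"
      by (simp add: scaleC_diff_left)
    also have "\<dots> = f y * ((1 - scaleC z x) * f z) - (f y * (1 - scaleC y x)) * f z"
      by (simp add: algebra_simps)
    finally show ?thesis by (simp add: l r)
  qed
  have bd: "norm (f y - f z) \<le> norm (f y) * (cmod (y - z) * C)" for y
  proof -
    have "norm (f y - f z) \<le> norm (f y * scaleC (y - z) x) * norm (f z)"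
      unfolding id by (rule norm_mult_ineq)
    also have "\<dots> \<le> norm (f y) * norm (scaleC (y - z) x) * norm (f z)"
      by (intro mult_right_mono norm_mult_ineq norm_ge_zero)
    finally show ?thesis by (simp add: norm_scaleC C_def mult.assoc)
  qed
  have "((\<lambda>y. f y - f z) \<longlongrightarrow> 0) (at z)"
  proof (rule Lim_null_comparison)
    have lim: "((\<lambda>y. cmod (y - z) * C) \<longlongrightarrow> 0) (at z)"
      by (intro tendsto_eq_intros) auto
    then have "\<forall>\<^sub>F y in at z. cmod (y - z) * C < 1 / 2"
      by (rule order_tendstoD) simp
    then show "\<forall>\<^sub>F y in at z. norm (f y - f z) \<le> 2 * norm (f z) * (cmod (y - z) * C)"
    proof eventually_elim
      case (elim y)
      have "norm (f y) \<le> norm (f z) + norm (f y - f z)" by (metis norm_triangle_sub)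
      also have "norm (f y - f z) \<le> norm (f y) * (1 / 2)"
        using bd[of y] elim by (smt (verit) mult_left_mono norm_ge_zero)
      finally have "norm (f y) \<le> 2 * norm (f z)" by simp
      then show ?case using bd[of y] C
        by (smt (verit) mult_right_mono mult_nonneg_nonneg norm_ge_zero)
    qed
    show "((\<lambda>y. 2 * norm (f z) * (cmod (y - z) * C)) \<longlongrightarrow> 0) (at z)"
      using tendsto_mult_left[OF lim, of "2 * norm (f z)"] by simp
  qed
  then show ?thesis unfolding isCont_def using LIM_zero_cancel by blast
qed

text \<open>
  The partial fraction \<open>1 / (1 - y^2) = (1 / (1 - y) + 1 / (1 + y)) / 2\<close>, as a left inverse here and as
  a right inverse below.
\<close>

lemma resolvent_average:
  fixes y :: "'a::{real_normed_algebra, ring_1}"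
  assumes p: "p * (1 - y) = 1" and q: "q * (1 + y) = 1"
  shows "scaleR (1 / 2) (p + q) * (1 - y * y) = 1"
proof -
  have "p * (1 - y * y) = (p * (1 - y)) * (1 + y)" by (simp add: algebra_simps)
  moreover have "q * (1 - y * y) = (q * (1 + y)) * (1 - y)" by (simp add: algebra_simps)
  ultimately have "(p + q) * (1 - y * y) = 1 + 1" using p q by (simp add: distrib_right)
  then show ?thesis by (simp flip: scaleR_2)
qed

lemma resolvent_average_right:
  fixes y :: "'a::{real_normed_algebra, ring_1}"
  assumes p: "(1 - y) * p = 1" and q: "(1 + y) * q = 1"
  shows "(1 - y * y) * scaleR (1 / 2) (p + q) = 1"
proof -
  have "(1 - y * y) * p = (1 + y) * ((1 - y) * p)" by (simp add: algebra_simps)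
  moreover have "(1 - y * y) * q = (1 - y) * ((1 + y) * q)" by (simp add: algebra_simps)
  ultimately have "(1 - y * y) * (p + q) = 1 + 1" using p q by (simp add: distrib_left)
  then show ?thesis by (simp flip: scaleR_2)
qed

text \<open>
  This is the part of the spectral radius formula that is needed, proved by averaging over roots of
  unity in place of Cauchy's integral formula. Let \<open>f z\<close> be the inverse of \<open>1 - z x\<close>, and \<open>F k z\<close>
  that of \<open>1 - (z x)^(2^k)\<close>. By partial fractions, \<open>F k z\<close> is an average of values of \<open>f\<close> at points
  \<open>w z\<close> with \<open>w\<close> on the unit circle, so a modulus of continuity of \<open>f\<close> on the unit disc serves all
  the \<open>F k\<close> at once. If the powers of \<open>t x\<close> with exponents \<open>2^k\<close> tend to zero, then \<open>F k t\<close> is close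
  to \<open>1\<close> for large \<open>k\<close>. So is \<open>F k t'\<close> for \<open>t'\<close> within a fixed distance \<open>d\<close> of \<open>t\<close>, which forces a
  power of \<open>t' x\<close> to be small. Finitely many steps of a fixed length lead from \<open>t = 0\<close> to \<open>t = 1\<close>.
\<close>

lemma quasinilpotent_small_power:
  fixes x :: "'a::complex_banach_algebra_unital"
  assumes inv: "\<And>z. ring_invertible (1 - scaleC z x)"
  shows "\<exists>k. norm (x ^ (2 ^ k)) < 1"
proof -
  have "\<forall>z. \<exists>v. v * (1 - scaleC z x) = 1 \<and> (1 - scaleC z x) * v = 1"
    using inv unfolding ring_invertible_def by blast
  then obtain f where l: "\<And>z. f z * (1 - scaleC z x) = 1" and r: "\<And>z. (1 - scaleC z x) * f z = 1"
    by metis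
  define K where "K = norm (1 :: 'a)"
  have K: "K \<ge> 0" unfolding K_def by simp
  \<comment> \<open>The closeness \<open>2 * e\<close> of \<open>F k t'\<close> to \<open>1\<close> must make \<open>2 * K * (2 * e)\<close>, the resulting bound on
    the power of \<open>t' x\<close>, smaller than \<open>1\<close>.\<close>
  define e where "e = 1 / (8 * (K + 1))"
  have e: "e > 0" "4 * e \<le> 1 / 2" "2 * K * (2 * e) < 1"
    unfolding e_def using K by (auto simp: field_simps)
  have "uniformly_continuous_on (cball 0 1) f"
    using resolvent_continuous_at[of f x, OF l r]
    by (intro compact_uniformly_continuous continuous_at_imp_continuous_on) auto
  then obtain d where d: "d > 0"
    and uc: "\<And>z z'. cmod z \<le> 1 \<Longrightarrow> cmod z' \<le> 1 \<Longrightarrow> cmod (z - z') < d \<Longrightarrow> norm (f z - f z') < e"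
    unfolding uniformly_continuous_on_def dist_norm using e(1) by (metis mem_cball_0)
  have "\<exists>F. (\<forall>z. F z * (1 - scaleC z x ^ (2 ^ k)) = 1) \<and>
          (\<forall>z. (1 - scaleC z x ^ (2 ^ k)) * F z = 1) \<and>
          (\<forall>z z'. cmod z \<le> 1 \<longrightarrow> cmod z' \<le> 1 \<longrightarrow> cmod (z - z') < d \<longrightarrow> norm (F z - F z') < e)" for k
  proof (induction k)
    case 0
    show ?case using l r uc by (intro exI[of _ f]) simp
  next
    case (Suc k)
    then obtain F where F: "\<And>z. F z * (1 - scaleC z x ^ (2 ^ k)) = 1"
      and F': "\<And>z. (1 - scaleC z x ^ (2 ^ k)) * F z = 1"
      and uF: "\<And>z z'. cmod z \<le> 1 \<Longrightarrow> cmod z' \<le> 1 \<Longrightarrow> cmod (z - z') < d \<Longrightarrow> norm (F z - F z') < e"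
      by blast
    \<comment> \<open>Rotating \<open>z\<close> by \<open>w\<close> changes the sign of \<open>(z x)^(2^k)\<close> and preserves distances.\<close>
    define w where "w = cis (pi / 2 ^ k)"
    have w: "w ^ (2 ^ k) = -1" "cmod w = 1" unfolding w_def by (simp_all add: DeMoivre)
    define G where "G = (\<lambda>z. scaleR (1 / 2) (F z + F (w * z)))"
    have G: "G z * (1 - scaleC z x ^ (2 ^ Suc k)) = 1 \<and> (1 - scaleC z x ^ (2 ^ Suc k)) * G z = 1" for z
    proof -
      have "scaleC (w * z) x ^ (2 ^ k) = - (scaleC z x ^ (2 ^ k))"
        by (simp add: scaleC_power power_mult_distrib w scaleC_minus_left)
      then have "F (w * z) * (1 + scaleC z x ^ (2 ^ k)) = 1"
        "(1 + scaleC z x ^ (2 ^ k)) * F (w * z) = 1" using F[of "w * z"] F'[of "w * z"] by simp_all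
      from resolvent_average[OF F this(1)] resolvent_average_right[OF F' this(2)] show ?thesis
        unfolding G_def by (simp add: mult_2 flip: power_add)
    qed
    moreover have "norm (G z - G z') < e"
      if z: "cmod z \<le> 1" "cmod z' \<le> 1" "cmod (z - z') < d" for z z'
    proof -
      have "norm (F z - F z') < e" using z by (rule uF)
      moreover have "norm (F (w * z) - F (w * z')) < e"
        using z w by (intro uF) (simp_all add: norm_mult flip: right_diff_distrib)
      moreover have "G z - G z' = scaleR (1 / 2) ((F z - F z') + (F (w * z) - F (w * z')))"
        unfolding G_def by (simp add: algebra_simps)
      then have "norm (G z - G z') \<le> (norm (F z - F z') + norm (F (w * z) - F (w * z'))) / 2"
        using norm_triangle_ineq[of "F z - F z'" "F (w * z) - F (w * z')"] by simp
      ultimately show ?thesis by simp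
    qed
    ultimately show ?case by blast
  qed
  then obtain F where F: "\<And>k z. F k z * (1 - scaleC z x ^ (2 ^ k)) = 1"
    and F': "\<And>k z. (1 - scaleC z x ^ (2 ^ k)) * F k z = 1"
    and uF: "\<And>k z z'. cmod z \<le> 1 \<Longrightarrow> cmod z' \<le> 1 \<Longrightarrow> cmod (z - z') < d \<Longrightarrow> norm (F k z - F k z') < e"
    by metis
  \<comment> \<open>One power of norm below \<open>1\<close> is enough, as each further squaring at least squares the norm bound.\<close>
  have sq: "(\<lambda>i. norm (y ^ (2 ^ i))) \<longlonglongrightarrow> 0" if k: "norm (y ^ (2 ^ k)) < 1" for y :: 'a and k
  proof -
    define s where "s = norm (y ^ (2 ^ k))"
    have s: "0 \<le> s" "s < 1" using k unfolding s_def by auto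
    have b: "norm (y ^ (2 ^ (i + k))) \<le> s ^ (2 ^ i)" for i
    proof (induction i)
      case (Suc i)
      have "y ^ (2 ^ (Suc i + k)) = y ^ (2 ^ (i + k)) * y ^ (2 ^ (i + k))"
        by (simp add: mult_2 flip: power_add)
      then have "norm (y ^ (2 ^ (Suc i + k))) \<le> norm (y ^ (2 ^ (i + k))) * norm (y ^ (2 ^ (i + k)))"
        by (simp only: norm_mult_ineq)
      also have "\<dots> \<le> s ^ (2 ^ i) * s ^ (2 ^ i)" using Suc s by (intro mult_mono) auto
      finally show ?case by (simp add: mult_2 power_add)
    qed (simp add: s_def)
    have "(\<lambda>i. s ^ (2 ^ i)) \<longlonglongrightarrow> 0"
    proof (rule tendsto_sandwich[of "\<lambda>_. 0"])
      show "\<forall>\<^sub>F i in sequentially. s ^ (2 ^ i) \<le> s ^ i"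
        using s by (intro always_eventually allI power_decreasing) (auto intro: less_imp_le)
      show "(\<lambda>i. s ^ i) \<longlonglongrightarrow> 0" using s by (intro LIMSEQ_realpow_zero)
    qed (use s in auto)
    then have "(\<lambda>i. norm (y ^ (2 ^ (i + k)))) \<longlonglongrightarrow> 0"
      by (rule Lim_null_comparison[rotated]) (use b in \<open>simp add: always_eventually\<close>)
    then show ?thesis by (rule LIMSEQ_offset)
  qed
  have step: "\<exists>k. norm (scaleC (of_real t) x ^ (2 ^ k)) < 1"
    if "0 \<le> t" "t \<le> 1" "t \<le> real m * (d / 2)" for t m
    using that
  proof (induction m arbitrary: t)
    case 0
    then have "t = 0" by simp
    then show ?case by (intro exI[of _ 0]) simp
  next
    case (Suc m)
    \<comment> \<open>A step of \<open>d / 2\<close>, half the modulus of continuity, because the latter is a strict bound.\<close>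
    define t0 where "t0 = max 0 (t - d / 2)"
    have t0: "0 \<le> t0" "t0 \<le> 1" "t0 \<le> real m * (d / 2)" "\<bar>t0 - t\<bar> < d"
      using Suc.prems d by (auto simp: t0_def max_def algebra_simps)
    define v0 where "v0 = scaleC (of_real t0) x"
    define v where "v = scaleC (of_real t) x"
    from Suc.IH[OF t0(1-3)] have lim: "(\<lambda>i. norm (v0 ^ (2 ^ i))) \<longlonglongrightarrow> 0"
      unfolding v0_def using sq by blast
    have "min (1/2) (e / (2 * K + 1)) > 0" using e K by simp
    from eventually_happens[OF order_tendstoD(2)[OF lim this]]
    obtain i where i: "norm (v0 ^ (2 ^ i)) < 1 / 2" "norm (v0 ^ (2 ^ i)) < e / (2 * K + 1)" by auto
    have "norm (F i t0 - 1) \<le> 2 * K * norm (v0 ^ (2 ^ i))"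
      using norm_inverse_minus_one_le[OF F[of i "of_real t0"]] i by (simp add: v0_def K_def)
    also have "\<dots> \<le> (2 * K + 1) * norm (v0 ^ (2 ^ i))" by (intro mult_right_mono) auto
    also have "\<dots> \<le> e" using i(2) K by (simp add: field_simps)
    finally have A: "norm (F i t0 - 1) \<le> e" .
    have "norm (F i (of_real t) - F i (of_real t0)) < e"
      using Suc.prems t0 by (intro uF) (simp_all add: abs_minus_commute flip: of_real_diff)
    then have B: "norm (F i t - 1) \<le> 2 * e"
      using A norm_triangle_ineq[of "F i t - F i t0" "F i t0 - 1"] by simp
    have "2 * e \<le> 1 / 2" using e by simp
    then have half: "norm (F i t - 1) \<le> 1 / 2" using B by simp
    have comm: "(1 - v ^ (2 ^ i)) * F i t = 1" unfolding v_def by (rule F')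
    have "norm ((1 - v ^ (2 ^ i)) - 1) \<le> 2 * K * norm (F i t - 1)"
      unfolding K_def using comm half by (rule norm_inverse_minus_one_le)
    also have "\<dots> \<le> 2 * K * (2 * e)" using B K by (intro mult_left_mono) auto
    also have "\<dots> < 1" by (rule e)
    finally show ?case unfolding v_def by (intro exI[of _ i]) simp
  qed
  have "d / 2 > 0" using d by simp
  then obtain m where "1 < real m * (d / 2)" using reals_Archimedean3 by blast
  then show ?thesis using step[of 1 m] by simp
qed

text \<open>
  The partial sums \<open>S\<close> satisfy \<open>S m \<le> S (N + m) \<le> S N + norm (x^N) * S m\<close>, and solving for \<open>S m\<close> bounds
  them.
\<close>

lemma summable_norm_powers:
  fixes x :: "'a::{real_normed_algebra, ring_1}"
  assumes "norm (x ^ N) < 1"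
  shows "summable (\<lambda>i. norm (x ^ i))"
proof (rule summableI_nonneg_bounded)
  fix m
  define S where "S = (\<lambda>k. \<Sum>i<k. norm (x ^ i))"
  have "S m \<le> S (N + m)" unfolding S_def by (intro sum_mono2) auto
  also have "S (N + m) = S N + (\<Sum>i<m. norm (x ^ (N + i)))"
    unfolding S_def
    using sum.atLeastLessThan_concat[of 0 N "N + m" "\<lambda>i. norm (x ^ i)"]
      sum.shift_bounds_nat_ivl[of "\<lambda>i. norm (x ^ i)" 0 N m]
    by (simp add: lessThan_atLeast0 add.commute)
  also have "(\<Sum>i<m. norm (x ^ (N + i))) \<le> (\<Sum>i<m. norm (x ^ N) * norm (x ^ i))"
    unfolding power_add by (intro sum_mono norm_mult_ineq)
  also have "\<dots> = norm (x ^ N) * S m" unfolding S_def by (simp add: sum_distrib_left)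
  finally have "S m * (1 - norm (x ^ N)) \<le> S N" by (simp add: algebra_simps)
  then have "S m \<le> S N / (1 - norm (x ^ N))" using assms by (simp add: pos_le_divide_eq)
  then show "(\<Sum>i<m. norm (x ^ i)) \<le> S N / (1 - norm (x ^ N))"
    by (simp add: S_def)
qed simp

lemma abs_gbinomial_minus_half_le: "\<bar>(- 1 / 2 :: real) gchoose k\<bar> \<le> 1"
proof (induction k)
  case (Suc k)
  have "(- 1 / 2 :: real) gchoose Suc k = ((- 1 / 2) gchoose k) * ((- 1 / 2 - real k) / (real k + 1))"
    using gbinomial_absorb_comp[of "- 1 / 2 :: real" k] gbinomial_absorption[of k "- 1 / 2 :: real"]
      gbinomial_mult_1[of "- 1 / 2 :: real" k]
    by (simp add: field_simps)
  moreover have "\<bar>(- 1 / 2 - real k) / (real k + 1)\<bar> \<le> 1" by (simp add: field_simps)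
  ultimately show ?case using Suc by (simp only: abs_mult mult_le_one abs_ge_zero)
qed simp

text \<open>
  Here \<open>1 + x t\<close> is \<open>(1 + x)^(-1/2)\<close>, given by the binomial series; by the Vandermonde identity its
  square is the geometric series of \<open>- x\<close>. The first term is split off because the application needs
  that the root differs from \<open>1\<close> by a multiple of \<open>x\<close>, not only by something small.
\<close>

lemma inverse_sqrt_one_plus:
  fixes x :: "'a::{real_normed_algebra, ring_1, banach}"
  assumes "norm (x ^ N) < 1"
  obtains t where "(1 + x * t) * (1 + x * t) * (1 + x) = 1"
    and "\<And>y. y * x = x * y \<Longrightarrow> y * t = t * y"
proof -
  define c where "c = (\<lambda>k. (- 1 / 2 :: real) gchoose k)"
  have c: "\<bar>c k\<bar> \<le> 1" for k unfolding c_def by (rule abs_gbinomial_minus_half_le)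
  have s: "summable (\<lambda>i. norm (x ^ i))" using assms by (rule summable_norm_powers)
  have sn: "summable (\<lambda>i. norm (scaleR (b i) (x ^ i)))" if "\<And>i. \<bar>b i\<bar> \<le> 1" for b :: "nat \<Rightarrow> real"
    by (rule summable_comparison_test'[OF s, of 0]) (use that in \<open>simp add: mult_left_le_one_le\<close>)
  have sc: "summable (\<lambda>i. scaleR (b i) (x ^ i))" if "\<And>i. \<bar>b i\<bar> \<le> 1" for b :: "nat \<Rightarrow> real"
    using sn[OF that] by (rule summable_norm_cancel)
  define t where "t = (\<Sum>i. scaleR (c (Suc i)) (x ^ i))"
  define w where "w = (\<Sum>i. scaleR (c i) (x ^ i))"
  have st: "summable (\<lambda>i. scaleR (c (Suc i)) (x ^ i))" by (rule sc) (rule c)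
  have w: "w = 1 + x * t"
  proof -
    have "w = scaleR (c 0) (x ^ 0) + (\<Sum>i. scaleR (c (Suc i)) (x ^ Suc i))"
      unfolding w_def using suminf_split_head[OF sc[of c, OF c]] by simp
    also have "(\<Sum>i. scaleR (c (Suc i)) (x ^ Suc i)) = x * t"
      unfolding t_def suminf_mult[OF st, symmetric] by simp
    finally show ?thesis by (simp add: c_def)
  qed
  have "w * w = (\<Sum>k. \<Sum>i\<le>k. scaleR (c i) (x ^ i) * scaleR (c (k - i)) (x ^ (k - i)))"
    unfolding w_def by (rule Cauchy_product) (rule sn, rule c)+
  also have "\<dots> = (\<Sum>k. scaleR ((-1) ^ k) (x ^ k))"
  proof (rule suminf_cong)
    fix k
    have "(\<Sum>i\<le>k. scaleR (c i) (x ^ i) * scaleR (c (k - i)) (x ^ (k - i)))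
        = (\<Sum>i\<le>k. scaleR (c i * c (k - i)) (x ^ k))"
      by (intro sum.cong) (simp_all flip: power_add)
    also have "\<dots> = scaleR (\<Sum>i\<le>k. c i * c (k - i)) (x ^ k)" by (simp add: scaleR_sum_left)
    also have "(\<Sum>i\<le>k. c i * c (k - i)) = (- 1 / 2 + - 1 / 2) gchoose k"
      unfolding c_def using gbinomial_Vandermonde[of "- 1 / 2 :: real" "- 1 / 2" k]
      by (simp add: atLeast0AtMost)
    also have "\<dots> = (-1) ^ k" 
      using gbinomial_minus[of "1::real" k] binomial_gbinomial[of k k, where 'a = real] by simp
    finally show "(\<Sum>i\<le>k. scaleR (c i) (x ^ i) * scaleR (c (k - i)) (x ^ (k - i)))
        = scaleR ((-1) ^ k) (x ^ k)" .
  qed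
  also have "\<dots> * (1 + x) = 1"
  proof -
    let ?g = "\<lambda>k. scaleR ((-1) ^ k) (x ^ k)"
    have sg: "summable ?g" by (rule sc) (simp add: power_abs)
    have "(\<Sum>k. ?g k) * x = (\<Sum>k. ?g k * x)" by (rule suminf_mult2[OF sg])
    also have "\<dots> = (\<Sum>k. - ?g (Suc k))" by (simp add: power_commutes)
    also have "\<dots> = - (\<Sum>k. ?g (Suc k))"
      using sg summable_Suc_iff[of ?g] by (intro suminf_minus) simp
    also have "(\<Sum>k. ?g (Suc k)) = (\<Sum>k. ?g k) - 1" using suminf_split_head[OF sg] by simp
    finally show ?thesis by (simp add: distrib_left)
  qed
  finally have "w * w * (1 + x) = 1" .
  moreover have "y * t = t * y" if y: "y * x = x * y" for y
  proof -
    have "y * x ^ i = x ^ i * y" for i using y by (metis power_commuting_commutes)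
    then show ?thesis unfolding t_def suminf_mult[OF st, symmetric] suminf_mult2[OF st] by simp
  qed
  ultimately show ?thesis using that w by blast
qed

section \<open>The polynomial criterion: sufficiency\<close>

text \<open>
  The element \<open>s = 2u - 1\<close> satisfies \<open>s^2 = 1 + x\<close> with \<open>x = -4 (u - u^2)\<close> quasinilpotent. Dividing \<open>s\<close> by
  \<open>(1 + x)^(1/2)\<close> gives a square root \<open>r\<close> of \<open>1\<close>, that is, an idempotent \<open>e = (1 + r) / 2\<close>. The
  correcting factor differs from \<open>1\<close> by a multiple of \<open>x\<close>, so \<open>u - e\<close> is a commuting multiple of \<open>u - u^2\<close>.
\<close>

lemma spectral_idempotent:
  fixes u :: "'a::complex_banach_algebra_unital"
  assumes J: "(u - u * u) ^ k \<in> jacobson_radical"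
  obtains e where "e * e = e" "(u - e) ^ k \<in> jacobson_radical"
    and "\<And>y. y * u = u * y \<Longrightarrow> y * e = e * y"
proof -
  define j where "j = u - u * u"
  define x where "x = scaleR (- 4) j"
  define s where "s = u + u - 1"
  have "ring_invertible (1 - scaleC z x)" for z
  proof (rule ring_invertible_one_minus)
    have "scaleC z x = j * scaleC z (scaleR (- 4) 1)"
      unfolding x_def by (simp add: mult_scaleC_right)
    moreover have "j * scaleC z (scaleR (- 4) 1) = scaleC z (scaleR (- 4) 1) * j"
      by (simp add: mult_scaleC_right mult_scaleC_left)
    ultimately show "scaleC z x ^ k \<in> jacobson_radical"
      using jacobson_radical_power_multiple[OF J] by (simp only: j_def)
  qed
  then obtain i where i: "norm (x ^ (2 ^ i)) < 1" using quasinilpotent_small_power by blast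
  obtain t where w: "(1 + x * t) * (1 + x * t) * (1 + x) = 1"
    and comm: "\<And>y. y * x = x * y \<Longrightarrow> y * t = t * y"
    using inverse_sqrt_one_plus[OF i] by blast
  have ux: "u * x = x * u" unfolding x_def j_def by (simp add: algebra_simps)
  then have ut: "u * t = t * u" by (rule comm)
  have s2: "s * s = 1 + x"
  proof -
    have "x = - (j + j + j + j)" unfolding x_def
      using scaleR_add_left[of 1 3 j] scaleR_add_left[of 1 2 j] scaleR_add_left[of 1 1 j] by simp
    then show ?thesis unfolding s_def j_def by (simp add: algebra_simps)
  qed
  define r where "r = s * (1 + x * t)"
  have sx: "s * x = x * s" unfolding s_def using ux by (simp add: algebra_simps)
  have st: "s * t = t * s" unfolding s_def using ut by (simp add: algebra_simps)
  have xts: "s * (x * t) = (x * t) * s" using sx st by (rule commutes_mult)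
  have ws: "s * (1 + x * t) = (1 + x * t) * s" using xts by (simp add: distrib_left distrib_right)
  have "r * r = (1 + x * t) * (1 + x * t) * (s * s)" unfolding r_def ws
    by (simp only: mult.assoc) (simp only: ws flip: mult.assoc)
  then have r2: "r * r = 1" using w s2 by simp
  define e where "e = scaleR (1 / 2) (1 + r)"
  have "(1 + r) * (1 + r) = (1 + r) + (1 + r)" using r2 by (simp add: algebra_simps)
  then have "e * e = e" unfolding e_def by (simp flip: scaleR_2)
  moreover have "(u - e) ^ k \<in> jacobson_radical"
  proof -
    have "u - e = scaleR (1 / 2) ((u + u) - (1 + r))"
      unfolding e_def by (simp add: scaleR_diff_right flip: scaleR_2)
    also have "(u + u) - (1 + r) = - (x * t * s)"
      unfolding r_def ws by (simp add: s_def algebra_simps)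
    also have "scaleR (1 / 2) (- (x * t * s)) = j * scaleR 2 (t * s)"
      unfolding x_def by (simp add: mult.assoc)
    finally have *: "u - e = j * scaleR 2 (t * s)" .
    have ju: "j * u = u * j" unfolding j_def by (simp add: algebra_simps)
    have "j * t = t * j" by (rule comm) (simp add: x_def)
    moreover have "j * s = s * j" unfolding s_def using ju by (simp add: algebra_simps)
    ultimately have "j * (t * s) = (t * s) * j" by (rule commutes_mult)
    then have "j * scaleR 2 (t * s) = scaleR 2 (t * s) * j" by simp
    then show ?thesis using J jacobson_radical_power_multiple[of j k] unfolding * by (simp only: j_def)
  qed
  moreover have "y * e = e * y" if y: "y * u = u * y" for y
  proof -
    have "y * j = j * y" unfolding j_def using y commutes_mult[OF y y]
      by (simp add: right_diff_distrib left_diff_distrib)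
    then have yx: "y * x = x * y" unfolding x_def by simp
    then have yt: "y * t = t * y" by (rule comm)
    have ys: "y * s = s * y" unfolding s_def using y by (simp add: algebra_simps)
    have "y * (x * t) = (x * t) * y" using yx yt by (rule commutes_mult)
    then have "y * (1 + x * t) = (1 + x * t) * y" by (simp add: distrib_left distrib_right)
    with ys have "y * r = r * y" unfolding r_def by (rule commutes_mult)
    then show ?thesis unfolding e_def by (simp add: distrib_left distrib_right)
  qed
  ultimately show ?thesis by (rule that)
qed

text \<open>
  With \<open>e\<close> the idempotent attached to \<open>c^n\<close>, the element \<open>d = c^n e + (1 - e)\<close> is \<open>1\<close> plus a commuting
  multiple of \<open>c^n - e\<close>, hence invertible. Therefore \<open>c^(n-1) e / d\<close> inverts \<open>c\<close> in the corner of
  \<open>e\<close>.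
\<close>

lemma power_radical_imp_pns_Drazin:
  fixes c :: "'a::complex_banach_algebra_unital"
  assumes n: "n > 0" and k: "k > 0" and J: "(c ^ n - c ^ n * c ^ n) ^ k \<in> jacobson_radical"
  shows "c \<in> pnsD n"
proof -
  obtain e where e: "e * e = e" and Je: "(c ^ n - e) ^ k \<in> jacobson_radical"
    and comm: "\<And>y. y * c ^ n = c ^ n * y \<Longrightarrow> y * e = e * y"
    using spectral_idempotent[OF J] by blast
  have comm_e: "y * e = e * y" if "y * c = c * y" for y
    using that by (intro comm) (metis power_commuting_commutes)
  have ce: "c ^ i * e = e * c ^ i" for i by (rule comm_e) (simp add: power_commutes)
  define d where "d = 1 - (c ^ n - e) * (- e)"
  have "(c ^ n - e) * (- e) = - e * (c ^ n - e)" using ce by (simp add: algebra_simps)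
  then have "ring_invertible d"
    unfolding d_def using Je by (intro ring_invertible_one_minus jacobson_radical_power_multiple)
  then obtain v where v: "d * v = 1" "v * d = 1" unfolding ring_invertible_def by blast
  have d: "d = 1 + c ^ n * e - e" unfolding d_def using e by (simp add: algebra_simps)
  define x where "x = c ^ (n - 1) * e * v"
  have comm_x: "y * x = x * y" if y: "y * c = c * y" for y
  proof -
    have yc: "y * c ^ i = c ^ i * y" for i using y by (metis power_commuting_commutes)
    have ye: "y * e = e * y" using y by (rule comm_e)
    have "y * d = d * y" unfolding d using ye commutes_mult[OF yc ye, of n]
      by (simp add: distrib_left distrib_right left_diff_distrib right_diff_distrib)
    then have "y * v = v * y" by (rule inverse_commutes[OF v])
    then show ?thesis unfolding x_def using yc ye by (intro commutes_mult)
  qed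
  have cx: "c * x = e"
  proof -
    have "c * c ^ (n - 1) = c ^ n" using n by (simp flip: power_Suc)
    then have cx': "c * x = c ^ n * e * v" unfolding x_def by (simp flip: mult.assoc)
    have "e * d = c ^ n * e"
    proof -
      have "e * (c ^ n * e) = c ^ n * (e * e)" by (metis ce mult.assoc)
      then show ?thesis unfolding d using e by (simp add: right_diff_distrib distrib_left)
    qed
    then have "c * x = e * (d * v)" using cx' by (simp flip: mult.assoc)
    then show ?thesis using v by simp
  qed
  have "x * c * x = x"
  proof -
    have "e * x = c ^ (n - 1) * (e * e) * v" unfolding x_def by (metis ce mult.assoc)
    then have "e * x = x" unfolding x_def e .
    then show ?thesis using comm_x[of c] cx by simp
  qed
  moreover have "x \<in> double_commutant c"
    unfolding double_commutant_def commutant_def using comm_x by auto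
  ultimately show ?thesis
    unfolding pnsD_def pns_Drazin_invertible_def using k Je cx by auto
qed

section \<open>The sum\<close>

text \<open>
  Since \<open>ab = 0\<close>, multiplication by \<open>a\<close> on the left turns \<open>c = a + b\<close> into \<open>a\<close>, and multiplication by \<open>b\<close>
  on the right turns it into \<open>b\<close>. Splitting the middle factor of \<open>F c F\<close>, where \<open>F = q(c)^k\<close>, as \<open>a + b\<close>
  brings each summand into the radical. One more factor \<open>q(c)\<close> between the two copies of \<open>F\<close>
  provides the \<open>c\<close>, whence the exponent \<open>k + 1 + k\<close>.
\<close>

lemma sum_power_radical:
  fixes a b :: "'a::ring_1"
  assumes n: "n > 0" and ab: "a * b = 0"
    and Ja: "(a ^ n - a ^ n * a ^ n) ^ k \<in> jacobson_radical"
    and Jb: "(b ^ n - b ^ n * b ^ n) ^ k \<in> jacobson_radical"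
  shows "((a + b) ^ n - (a + b) ^ n * (a + b) ^ n) ^ (k + 1 + k) \<in> jacobson_radical"
proof -
  define c where "c = a + b"
  define q where "q = (\<lambda>y::'a. y ^ n - y ^ n * y ^ n)"
  have qc: "y * q y ^ i = q y ^ i * y" for y i
  proof -
    have yp: "y * y ^ j = y ^ j * y" for j by (simp add: power_commutes)
    have "y * q y = q y * y" unfolding q_def using yp[of n] commutes_mult[OF yp yp, of n n]
      by (simp add: right_diff_distrib left_diff_distrib)
    then show ?thesis by (metis power_commuting_commutes)
  qed
  have acp: "a * c ^ i = a * a ^ i" for i
  proof (induction i)
    case (Suc i)
    have "a * c ^ Suc i = (a * c) * c ^ i" by (simp add: mult.assoc)
    also have "a * c = a * a" unfolding c_def using ab by (simp add: distrib_left)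
    finally show ?case using Suc by (simp add: mult.assoc)
  qed simp
  have cpb: "c ^ i * b = b ^ i * b" for i
  proof (induction i)
    case (Suc i)
    have "c ^ Suc i * b = c ^ i * (c * b)" by (simp add: power_Suc2 mult.assoc del: power_Suc)
    also have "c * b = b * b" unfolding c_def using ab by (simp add: distrib_right)
    finally show ?case using Suc by (simp add: mult.assoc[symmetric] power_commutes)
  qed simp
  have aq: "a * q c = a * q a"
    using acp[of n] acp[of "n + n"] unfolding q_def by (simp add: right_diff_distrib power_add)
  have qb: "q c * b = q b * b"
    using cpb[of n] cpb[of "n + n"] unfolding q_def by (simp add: left_diff_distrib power_add)
  have aqp: "a * q c ^ i = a * q a ^ i" for i
  proof (induction i)
    case (Suc i)
    have "a * q c ^ Suc i = (a * q c) * q c ^ i" by (simp add: mult.assoc)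
    also have "\<dots> = q a * (a * q c ^ i)" using aq qc[of a 1] by (simp add: mult.assoc)
    also have "\<dots> = a * q a ^ Suc i" using Suc qc[of a 1] by (simp flip: mult.assoc)
    finally show ?case .
  qed simp
  have qpb: "q c ^ i * b = q b ^ i * b" for i
  proof (induction i)
    case (Suc i)
    have "q c ^ Suc i * b = q c ^ i * (q c * b)" by (simp add: power_Suc2 mult.assoc del: power_Suc)
    also have "\<dots> = (q c ^ i * b) * q b" using qb qc[of b 1] by (simp add: mult.assoc)
    also have "\<dots> = q b ^ Suc i * b"
      using Suc qc[of b 1] by (simp add: power_Suc2 mult.assoc del: power_Suc)
    finally show ?case .
  qed simp
  define F where "F = q c ^ k"
  have "a * F \<in> jacobson_radical"
    unfolding F_def aqp using Ja by (simp add: q_def jacobson_radical_mult_left)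
  moreover have "F * b \<in> jacobson_radical"
    unfolding F_def qpb using Jb by (simp add: q_def jacobson_radical_mult_right)
  ultimately have "F * (a * F) + (F * b) * F \<in> jacobson_radical"
    by (simp add: jacobson_radical_add jacobson_radical_mult_left jacobson_radical_mult_right)
  also have "F * (a * F) + (F * b) * F = F * c * F" unfolding c_def by (simp add: algebra_simps)
  finally have FcF: "F * c * F \<in> jacobson_radical" .
  \<comment> \<open>The cofactor of \<open>c\<close> in \<open>q(c)\<close>, which exists because \<open>n > 0\<close>.\<close>
  define h where "h = c ^ (n - 1) - c ^ (n - 1) * c ^ n"
  have h: "q c = c * h"
    unfolding h_def q_def using n power_Suc[of c "n - 1"] by (simp add: right_diff_distrib flip: mult.assoc)
  have cp: "c * c ^ i = c ^ i * c" for i by (simp add: power_commutes)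
  have "h * c = c * h" unfolding h_def using cp[of "n - 1"] commutes_mult[OF cp cp, of "n - 1" n]
    by (simp add: right_diff_distrib left_diff_distrib)
  then have "h * q c = q c * h" unfolding h by (intro commutes_mult refl)
  then have hF: "h * F = F * h" unfolding F_def by (metis power_commuting_commutes)
  have "q c ^ (k + 1 + k) = F * (c * h) * F" unfolding F_def by (simp only: power_add power_one_right h)
  also have "\<dots> = (F * c * F) * h" using hF by (simp add: mult.assoc)
  finally have "q c ^ (k + 1 + k) \<in> jacobson_radical"
    using FcF by (simp add: jacobson_radical_mult_right)
  then show ?thesis unfolding q_def c_def .
qed

theorem theorem3p9:
  fixes a b :: "'a::complex_banach_algebra_unital"
    and n :: nat
  assumes "n > 0"
    and "a \<in> pnsD n"
    and "b \<in> pnsD n"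
    and "a * b = 0"
  shows "a + b \<in> pnsD n"
proof -
  obtain k where k: "(a ^ n - a ^ n * a ^ n) ^ k \<in> jacobson_radical"
    using assms(2) by (rule pns_Drazin_imp_power_radical)
  obtain l where l: "(b ^ n - b ^ n * b ^ n) ^ l \<in> jacobson_radical"
    using assms(3) by (rule pns_Drazin_imp_power_radical)
  define m where "m = max k l"
  have "((a + b) ^ n - (a + b) ^ n * (a + b) ^ n) ^ (m + 1 + m) \<in> jacobson_radical"
    using assms(1,4) jacobson_radical_power_mono[OF k] jacobson_radical_power_mono[OF l]
    by (intro sum_power_radical) (simp_all add: m_def)
  then show ?thesis by (rule power_radical_imp_pns_Drazin[rotated 2]) (use assms(1) in simp_all)
qed

end
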